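(* Let $n\ge 8$ be an integer divisible by $4$. Let $F$ be the graph with $n$ vertices $v_{i,j}$, $1\le i\le n/4$, $1\le j\le 4$, whose edges are colored as follows (first subscripts are taken modulo $n/4$): for each $1\le i\le n/4$, (1) $\{v_{i,1}v_{i,2},\,v_{i,3}v_{i,4}\}$ is a color class; (2) $\{v_{i,2}v_{i,3}\}$ and $\{v_{i,4}v_{i,1}\}$ are two distinct color classes, each a single edge; (3) $\{v_{i,3}v_{i+1,2},\,v_{i,4}v_{i+1,1}\}$ is a color class; and $F$ has no other edges. Then this is an edge coloring with exactly $n$ colors, in which $n/2$ color classes are matchings of size $2$ and $n/2$ color classes are single edges, and its rainbow girth is equal to $n/2$.
   Context: Graphs are finite and simple. An edge coloring of a graph $G$ is a family $\mathcal{F}=(F_1,\dots,F_m)$ of pairwise disjoint nonempty sets of edges with $\bigcup_{i=1}^m F_i=E(G)$; the sets $F_i$ are the color classes. A set of edges is rainbow for $\mathcal{F}$ if it contains at most one edge from each color class. The rainbow girth is the minimum length of a cycle in $G$ whose edge set is rainbow ($\infty$ if there is none). *)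

theory Defs
  imports Main "HOL-Library.Extended_Nat" "HOL-Library.Disjoint_Sets"
begin

definition finite_simple_graph :: "'a set \<Rightarrow> 'a set set \<Rightarrow> bool" where
  "finite_simple_graph V E \<longleftrightarrow> finite V \<and> (\<forall>e\<in>E. e \<subseteq> V \<and> card e = 2)"

(* The family (F_1, ..., F_m) is indexed by a finite set I of colors, so m = card I. *)
definition edge_coloring :: "'a set set \<Rightarrow> 'c set \<Rightarrow> ('c \<Rightarrow> 'a set set) \<Rightarrow> bool" where
  "edge_coloring E I F \<longleftrightarrow>
     finite I \<and> (\<forall>c\<in>I. F c \<noteq> {}) \<and> disjoint_family_on F I \<and> (\<Union>c\<in>I. F c) = E"

definition matching :: "'a set set \<Rightarrow> 'a set set \<Rightarrow> bool" where
  "matching E M \<longleftrightarrow> M \<subseteq> E \<and> disjoint M"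

definition rainbow :: "'c set \<Rightarrow> ('c \<Rightarrow> 'a set set) \<Rightarrow> 'a set set \<Rightarrow> bool" where
  "rainbow I F S \<longleftrightarrow> (\<forall>c\<in>I. \<forall>e\<in>S \<inter> F c. \<forall>f\<in>S \<inter> F c. e = f)"

(* A cycle is given by the list of its distinct vertices in cyclic order;
   its length is the length of the list. *)
definition cycle_edges :: "'a list \<Rightarrow> 'a set set" where
  "cycle_edges p = {{p ! i, p ! (Suc i mod length p)} | i. i < length p}"

definition is_cycle :: "'a set \<Rightarrow> 'a set set \<Rightarrow> 'a list \<Rightarrow> bool" where
  "is_cycle V E p \<longleftrightarrow>
     3 \<le> length p \<and> distinct p \<and> set p \<subseteq> V \<and> cycle_edges p \<subseteq> E"

(* The infimum of the empty set in enat is \<infinity>. *)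
definition rainbow_girth ::
    "'a set \<Rightarrow> 'a set set \<Rightarrow> 'c set \<Rightarrow> ('c \<Rightarrow> 'a set set) \<Rightarrow> enat" where
  "rainbow_girth V E I F =
     Inf {enat (length p) | p. is_cycle V E p \<and> rainbow I F (cycle_edges p)}"

(* The vertex v_{i,j} is the pair (i, j). *)
definition ladder_verts :: "nat \<Rightarrow> (nat \<times> nat) set" where
  "ladder_verts n = {1..n div 4} \<times> {1..4}"

(* i + 1 modulo n/4, with representatives 1, ..., n/4. *)
definition next_idx :: "nat \<Rightarrow> nat \<Rightarrow> nat" where
  "next_idx n i = i mod (n div 4) + 1"

(* The four color classes belonging to a given first subscript i. *)
datatype color_kind = Rungs | Rail23 | Rail41 | Link

definition ladder_colors :: "nat \<Rightarrow> (nat \<times> color_kind) set" where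
  "ladder_colors n = {1..n div 4} \<times> UNIV"

fun ladder_class :: "nat \<Rightarrow> nat \<times> color_kind \<Rightarrow> (nat \<times> nat) set set" where
  "ladder_class n (i, Rungs)  = {{(i, 1), (i, 2)}, {(i, 3), (i, 4)}}"
| "ladder_class n (i, Rail23) = {{(i, 2), (i, 3)}}"
| "ladder_class n (i, Rail41) = {{(i, 4), (i, 1)}}"
| "ladder_class n (i, Link)   =
     {{(i, 3), (next_idx n i, 2)}, {(i, 4), (next_idx n i, 1)}}"

definition ladder_edges :: "nat \<Rightarrow> (nat \<times> nat) set set" where
  "ladder_edges n = (\<Union>c\<in>ladder_colors n. ladder_class n c)"

end

(*
  F is a circular ladder cut into n/4 blocks, the block i consisting of v_{i,1}, ..., v_{i,4}.
  If a cycle meets a set of vertices and its complement, then it has two distinct edges between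
  them.  For a block the only such edges are the links to its two neighbours, and a rainbow cycle
  takes at most one link on each side.  Hence a rainbow cycle that leaves some block passes through
  every block, entering at v_{i,1} or v_{i,2} and leaving at v_{i,3} or v_{i,4}, so it has at least
  2 (n/4) vertices.  A rainbow cycle inside one block does not exist: it cannot use both edges
  between {v_{i,1}, v_{i,4}} and {v_{i,2}, v_{i,3}}, so it would have at most two vertices.  The
  bound is attained by v_{1,1} v_{1,4} v_{2,1} v_{2,4} ...
*)
theory Submission imports Defs begin

section \<open>Cycles as cyclic lists, and the edges by which they cross a cut\<close>

lemma cyclic_exit:
  fixes p :: "'a list"
  assumes "set p \<inter> B \<noteq> {}" "\<not> set p \<subseteq> B"
  obtains j where "j < length p" "p ! j \<in> B" "p ! (Suc j mod length p) \<notin> B"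
proof (rule ccontr)
  assume "\<not> thesis"
  with that have step: "p ! (Suc j mod length p) \<in> B" if "j < length p" "p ! j \<in> B" for j
    using \<open>j < length p\<close> \<open>p ! j \<in> B\<close> by blast
  obtain a where a: "a < length p" "p ! a \<in> B"
    using assms(1) by (auto simp: in_set_conv_nth)
  obtain b where b: "b < length p" "p ! b \<notin> B"
    using assms(2) by (auto simp: in_set_conv_nth subset_iff)
  \<comment> \<open>Without an exit, membership in \<open>B\<close> is passed on from position
    \<open>a\<close> to all its cyclic successors.\<close>
  have "p ! ((a + t) mod length p) \<in> B" for t
  proof (induction t)
    case 0
    then show ?case using a by simp
  next
    case (Suc t)
    have "(a + t) mod length p < length p"
      using a(1) by (intro mod_less_divisor) auto
    from step[OF this Suc] show ?case
      by (simp add: mod_Suc_eq)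
  qed
  \<comment> \<open>Since \<open>a < length p\<close>, this shift takes \<open>a\<close> to
    \<open>length p + b\<close>, which is \<open>b\<close> modulo the length.\<close>
  from this[of "length p - a + b"] show False
    using a(1) b by simp
qed

text \<open>Traversed in cyclic order, one edge is an exit from \<open>B\<close> and the other an
  exit from the complement of \<open>B\<close>, that is, a re-entry. Only in a closed walk of length
  2 could these be the same edge.\<close>

lemma cycle_crossing_edges:
  assumes cyc: "is_cycle V E p" and B: "set p \<inter> B \<noteq> {}" "\<not> set p \<subseteq> B"
  obtains x y x' y' where
    "{x, y} \<in> cycle_edges p" "x \<in> B" "y \<notin> B"
    "{x', y'} \<in> cycle_edges p" "x' \<in> B" "y' \<notin> B"
    "{x, y} \<noteq> {x', y'}"
proof -
  let ?s = "\<lambda>j. Suc j mod length p"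
  have len: "3 \<le> length p" and dist: "distinct p"
    using cyc by (auto simp: is_cycle_def)
  obtain j where j: "j < length p" "p ! j \<in> B" "p ! ?s j \<notin> B"
    using cyclic_exit[OF B] .
  obtain k where k: "k < length p" "p ! k \<notin> B" "p ! ?s k \<in> B"
    using cyclic_exit[of p "- B"] B by blast
  have s: "?s i < length p" for i
    using len by (intro mod_less_divisor) auto
  have "{p ! j, p ! ?s j} \<noteq> {p ! ?s k, p ! k}"
  proof
    assume "{p ! j, p ! ?s j} = {p ! ?s k, p ! k}"
    then have "p ! j = p ! ?s k" "p ! ?s j = p ! k"
      using j k by (auto simp: doubleton_eq_iff)
    then have "j = ?s k" "?s j = k"
      using j(1) k(1) s dist by (simp_all add: nth_eq_iff_index_eq)
    \<comment> \<open>Two steps along the cycle would lead from \<open>j\<close> back to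
      \<open>j\<close>, against length at least 3.\<close>
    then show False
      using j(1) k(1) len by (auto simp: mod_Suc split: if_splits)
  qed
  moreover have "{p ! j, p ! ?s j} \<in> cycle_edges p"
    using j(1) by (auto simp: cycle_edges_def)
  moreover have "{p ! ?s k, p ! k} \<in> cycle_edges p"
    using k(1) by (auto simp: cycle_edges_def insert_commute)
  ultimately show thesis
    using that j k by blast
qed

lemma cycle_edge_subset:
  assumes "e \<in> cycle_edges p"
  shows "e \<subseteq> set p"
proof -
  obtain j where "j < length p" "e = {p ! j, p ! (Suc j mod length p)}"
    using assms by (auto simp: cycle_edges_def)
  moreover from this have "Suc j mod length p < length p"
    by (intro mod_less_divisor) auto
  ultimately show ?thesis by auto
qed

lemma UNIV_color_kind: "(UNIV :: color_kind set) = {Rungs, Rail23, Rail41, Link}"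
  using color_kind.exhaust by auto

section \<open>The ladder with \<open>m\<close> blocks: cyclic indices and the color classes\<close>

context
  fixes n m :: nat
  assumes n: "n = 4 * m" and m: "m \<ge> 2"
begin

lemma n_div: "n div 4 = m" "n div 2 = 2 * m"
  using n by simp_all

text \<open>This rests on \<open>m\<close> \<ge> 2: with a single block the links would coincide
  with the rails.\<close>

lemma next_idx_neq: "i \<in> {1..m} \<Longrightarrow> next_idx n i \<noteq> i"
  using n m by (cases "i = m") (auto simp: next_idx_def)

lemma next_idx_in: "next_idx n i \<in> {1..m}"
  using n m by (auto simp: next_idx_def Suc_le_eq)

text \<open>Only \<open>m\<close> wraps around to \<open>1\<close>. Consequently each block has just
  one predecessor, and all links entering it have the same color.\<close>

lemma next_idx_inj: "inj_on (next_idx n) {1..m}"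
proof (rule inj_onI)
  fix i j
  assume "i \<in> {1..m}" "j \<in> {1..m}" "next_idx n i = next_idx n j"
  then show "i = j"
    using n m by (cases "i = m"; cases "j = m") (auto simp: next_idx_def)
qed

lemma ladder_edges_cases:
  assumes "e \<in> ladder_edges n"
  obtains i k where "i \<in> {1..m}" "e \<in> ladder_class n (i, k)"
  using assms by (auto simp: ladder_edges_def ladder_colors_def n_div)

lemma ladder_class_subset: "i \<in> {1..m} \<Longrightarrow> ladder_class n (i, k) \<subseteq> ladder_edges n"
  unfolding ladder_edges_def ladder_colors_def n_div by blast

lemma ladder_simple: "finite_simple_graph (ladder_verts n) (ladder_edges n)"
  unfolding finite_simple_graph_def
proof (intro conjI ballI)
  show "finite (ladder_verts n)"
    by (simp add: ladder_verts_def)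
next
  fix e
  assume "e \<in> ladder_edges n"
  then obtain i k where i: "i \<in> {1..m}" and e: "e \<in> ladder_class n (i, k)"
    by (rule ladder_edges_cases)
  show "e \<subseteq> ladder_verts n"
    using i e next_idx_in[of i] by (cases k) (auto simp: ladder_verts_def n_div)
  show "card e = 2"
    using i e by (cases k) auto
qed

lemma ladder_edge_coloring: "edge_coloring (ladder_edges n) (ladder_colors n) (ladder_class n)"
proof -
  have "finite (ladder_colors n)"
    by (simp add: ladder_colors_def UNIV_color_kind)
  moreover have "ladder_class n c \<noteq> {}" for c
    by (cases "(n, c)" rule: ladder_class.cases) auto
  \<comment> \<open>Edges of different kinds differ in the second coordinates of their ends, except
    for a rail and a link; there, a rail stays in its block and a link does not.\<close>
  moreover have "ladder_class n (i, k) \<inter> ladder_class n (j, l) = {}"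
    if "(i, k) \<noteq> (j, l)" "i \<in> {1..m}" "j \<in> {1..m}" for i j k l
    using that next_idx_neq[of i] by (cases k; cases l) (auto simp: doubleton_eq_iff)
  ultimately show ?thesis
    by (auto simp: edge_coloring_def ladder_edges_def disjoint_family_on_def ladder_colors_def n_div)
qed

lemma card_ladder_class:
  "card (ladder_class n (i, k)) = (if k \<in> {Rungs, Link} then 2 else 1)"
  by (cases k) (auto simp: doubleton_eq_iff card_insert_if)

lemma ladder_class_matching:
  assumes "i \<in> {1..m}"
  shows "matching (ladder_edges n) (ladder_class n (i, k))"
proof -
  have "disjoint (ladder_class n (i, k))"
    using assms next_idx_neq[of i] by (cases k) (auto simp: disjoint_def)
  then show ?thesis
    using ladder_class_subset[OF assms] by (simp add: matching_def)
qed

lemma card_double_classes: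
  "card {c \<in> ladder_colors n.
      matching (ladder_edges n) (ladder_class n c) \<and> card (ladder_class n c) = 2} = n div 2"
proof -
  have "{c \<in> ladder_colors n.
      matching (ladder_edges n) (ladder_class n c) \<and> card (ladder_class n c) = 2}
    = {1..m} \<times> {Rungs, Link}"
    using ladder_class_matching
    by (auto simp: ladder_colors_def card_ladder_class n_div simp del: ladder_class.simps
        split: if_splits)
  then show ?thesis
    by (simp add: n_div card_cartesian_product)
qed

lemma card_single_classes:
  "card {c \<in> ladder_colors n. card (ladder_class n c) = 1} = n div 2"
proof -
  have "{c \<in> ladder_colors n. card (ladder_class n c) = 1} = {1..m} \<times> {Rail23, Rail41}"
  proof -
    have "card (ladder_class n (i, k)) = 1 \<longleftrightarrow> k \<in> {Rail23, Rail41}" for i k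
      unfolding card_ladder_class by (cases k) simp_all
    then show ?thesis
      by (auto simp: ladder_colors_def n_div simp del: ladder_class.simps One_nat_def)
  qed
  then show ?thesis
    by (simp add: n_div card_cartesian_product)
qed

section \<open>Lower bound: how a rainbow cycle passes through the blocks\<close>

lemma block_crossing_edge:
  assumes "{x, y} \<in> ladder_edges n" "fst x = i" "fst y \<noteq> i"
  shows "{x, y} \<in> ladder_class n (i, Link) \<and> snd x \<in> {3, 4} \<and> fst y = next_idx n i \<or>
    (\<exists>j\<in>{1..m}. next_idx n j = i \<and> {x, y} \<in> ladder_class n (j, Link) \<and> snd x \<in> {1, 2})"
proof -
  obtain j k where j: "j \<in> {1..m}" and e: "{x, y} \<in> ladder_class n (j, k)"
    using assms(1) by (rule ladder_edges_cases)
  \<comment> \<open>Rungs and rails have both ends in the same block.\<close>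
  have "k = Link"
    using e assms(2,3) by (cases k) (auto simp: doubleton_eq_iff)
  \<comment> \<open>A link starts at second coordinate 3 or 4 and ends at 2 or 1, so the position of
    \<open>x\<close> shows whether block \<open>i\<close> is left forwards or backwards.\<close>
  moreover from this have "j = i \<and> snd x \<in> {3, 4} \<and> fst y = next_idx n i \<or>
      next_idx n j = i \<and> snd x \<in> {1, 2}"
    using e assms(2,3) by (auto simp: doubleton_eq_iff)
  ultimately show ?thesis
    using j e by blast
qed

lemma rainbow_unique:
  assumes "rainbow (ladder_colors n) (ladder_class n) S" "i \<in> {1..m}"
    "e \<in> S" "f \<in> S" "e \<in> ladder_class n (i, k)" "f \<in> ladder_class n (i, k)"
  shows "e = f"
  using assms by (auto simp: rainbow_def ladder_colors_def n_div)

text \<open>The cut around the block is crossed by two edges of the cycle. They cannot both be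
  outgoing links or both be incoming links, since each of these pairs shares a color; so there is
  one of each. The last conclusion carries the cycle on to the next block.\<close>

lemma block_passage:
  assumes cyc: "is_cycle (ladder_verts n) (ladder_edges n) p"
    and rb: "rainbow (ladder_colors n) (ladder_class n) (cycle_edges p)"
    and i: "i \<in> {1..m}"
    and meets: "set p \<inter> {i} \<times> UNIV \<noteq> {}" and leaves: "\<not> set p \<subseteq> {i} \<times> UNIV"
  shows "set p \<inter> {i} \<times> {1, 2} \<noteq> {}" "set p \<inter> {i} \<times> {3, 4} \<noteq> {}"
    "set p \<inter> {next_idx n i} \<times> UNIV \<noteq> {}"
proof -
  have E: "cycle_edges p \<subseteq> ladder_edges n"
    using cyc by (simp add: is_cycle_def)
  obtain x y x' y' where
    xy: "{x, y} \<in> cycle_edges p" "fst x = i" "fst y \<noteq> i" and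
    xy': "{x', y'} \<in> cycle_edges p" "fst x' = i" "fst y' \<noteq> i" and
    ne: "{x, y} \<noteq> {x', y'}"
    using cycle_crossing_edges[OF cyc meets leaves] unfolding mem_Times_iff
    by (metis UNIV_I singleton_iff)
  have sub: "x \<in> set p" "y \<in> set p" "x' \<in> set p" "y' \<in> set p"
    using cycle_edge_subset[OF xy(1)] cycle_edge_subset[OF xy'(1)] by auto
  \<comment> \<open>The two cases are told apart by color and not by the neighboring block: for
    \<open>m\<close> = 2 both neighbors are the same block.\<close>
  let ?out = "\<lambda>x y. {x, y} \<in> ladder_class n (i, Link) \<and> snd x \<in> {3, 4} \<and> fst y = next_idx n i"
  let ?inc = "\<lambda>x y. \<exists>j\<in>{1..m}. next_idx n j = i \<and> {x, y} \<in> ladder_class n (j, Link)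
    \<and> snd x \<in> {1, 2}"
  have "?out x y \<or> ?inc x y" "?out x' y' \<or> ?inc x' y'"
    using block_crossing_edge xy xy' E by blast+
  moreover have "\<not> (?out x y \<and> ?out x' y')"
    using rainbow_unique[OF rb i xy(1) xy'(1)] ne by blast
  moreover have "\<not> (?inc x y \<and> ?inc x' y')"
  proof
    assume "?inc x y \<and> ?inc x' y'"
    then obtain j j' where
      "j \<in> {1..m}" "next_idx n j = i" "{x, y} \<in> ladder_class n (j, Link)"
      "j' \<in> {1..m}" "next_idx n j' = i" "{x', y'} \<in> ladder_class n (j', Link)"
      by blast
    moreover from this have "j = j'"
      using next_idx_inj by (auto dest: inj_onD)
    ultimately show False
      using rainbow_unique[OF rb _ xy(1) xy'(1)] ne by blast
  qed
  ultimately consider "?out x y" "?inc x' y'" | "?out x' y'" "?inc x y"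
    by blast
  then have "set p \<inter> {i} \<times> {1, 2} \<noteq> {} \<and> set p \<inter> {i} \<times> {3, 4} \<noteq> {} \<and>
    set p \<inter> {next_idx n i} \<times> UNIV \<noteq> {}"
  proof cases
    case 1
    then have "snd x' \<in> {1, 2}" "snd x \<in> {3, 4}" "fst y = next_idx n i"
      by blast+
    then have "x' \<in> {i} \<times> {1, 2}" "x \<in> {i} \<times> {3, 4}" "y \<in> {next_idx n i} \<times> UNIV"
      using xy(2) xy'(2) by (auto simp: mem_Times_iff prod_eq_iff)
    then show ?thesis using sub by blast
  next
    case 2
    then have "snd x \<in> {1, 2}" "snd x' \<in> {3, 4}" "fst y' = next_idx n i"
      by blast+
    then have "x \<in> {i} \<times> {1, 2}" "x' \<in> {i} \<times> {3, 4}" "y' \<in> {next_idx n i} \<times> UNIV"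
      using xy(2) xy'(2) by (auto simp: mem_Times_iff prod_eq_iff)
    then show ?thesis using sub by blast
  qed
  then show "set p \<inter> {i} \<times> {1, 2} \<noteq> {}" "set p \<inter> {i} \<times> {3, 4} \<noteq> {}"
    "set p \<inter> {next_idx n i} \<times> UNIV \<noteq> {}"
    by blast+
qed

lemma rainbow_cycle_leaves_block:
  assumes cyc: "is_cycle (ladder_verts n) (ladder_edges n) p"
    and rb: "rainbow (ladder_colors n) (ladder_class n) (cycle_edges p)"
    and i: "i \<in> {1..m}"
  shows "\<not> set p \<subseteq> {i} \<times> UNIV"
proof
  assume sub: "set p \<subseteq> {i} \<times> UNIV"
  \<comment> \<open>Within the block only the two rungs cross this cut, and they share a color. Each
    side has just two vertices, so a cycle inside the block meets both sides.\<close>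
  let ?B = "{(i, 1), (i, 4)} :: (nat \<times> nat) set"
  have card: "card (set p) \<ge> 3"
    using cyc by (auto simp: is_cycle_def distinct_card)
  have verts: "set p \<subseteq> {(i, 1), (i, 2), (i, 3), (i, 4)}"
  proof
    fix v
    assume v: "v \<in> set p"
    then have "v \<in> ladder_verts n"
      using cyc by (auto simp: is_cycle_def)
    moreover have "{1..4} = {1, 2, 3, 4 :: nat}"
      by auto
    ultimately show "v \<in> {(i, 1), (i, 2), (i, 3), (i, 4)}"
      using v sub by (auto simp: ladder_verts_def)
  qed
  have leaves: "\<not> set p \<subseteq> ?B"
  proof
    assume "set p \<subseteq> ?B"
    from card_mono[OF _ this] card show False by simp
  qed
  have meets: "set p \<inter> ?B \<noteq> {}"
  proof
    assume "set p \<inter> ?B = {}"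
    then have "set p \<subseteq> {(i, 2), (i, 3)}"
      using verts by blast
    from card_mono[OF _ this] card show False by simp
  qed
  obtain x y x' y' where
    xy: "{x, y} \<in> cycle_edges p" "x \<in> ?B" "y \<notin> ?B" and
    xy': "{x', y'} \<in> cycle_edges p" "x' \<in> ?B" "y' \<notin> ?B" and
    ne: "{x, y} \<noteq> {x', y'}"
    by (rule cycle_crossing_edges[OF cyc meets leaves])
  have rung: "{x, y} \<in> ladder_class n (i, Rungs)"
    if "{x, y} \<in> cycle_edges p" "x \<in> ?B" "y \<notin> ?B" for x y
  proof -
    have "{x, y} \<in> ladder_edges n"
      using cyc that(1) by (auto simp: is_cycle_def)
    then obtain j k where j: "j \<in> {1..m}" and e: "{x, y} \<in> ladder_class n (j, k)"
      by (rule ladder_edges_cases)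
    \<comment> \<open>With both ends in block \<open>i\<close> the edge is no link, and a rail does
      not cross the cut.\<close>
    have "fst y = i"
      using cycle_edge_subset[OF that(1)] sub by auto
    then show ?thesis
      using j e that(2,3) next_idx_neq[OF j]
      by (cases k) (auto simp: doubleton_eq_iff)
  qed
  show False
    using rainbow_unique[OF rb i xy(1) xy'(1) rung[OF xy] rung[OF xy']] ne by blast
qed

text \<open>Starting from \<open>a\<close>, the successor map climbs to \<open>m\<close>, wraps
  around to \<open>1\<close> and climbs again to \<open>b\<close>.\<close>

lemma next_idx_induct:
  assumes a: "a \<in> {1..m}" "P a"
    and step: "\<And>i. i \<in> {1..m} \<Longrightarrow> P i \<Longrightarrow> P (next_idx n i)"
    and b: "b \<in> {1..m}"
  shows "P b"
proof -
  have up: "P c" if "P d" "d \<le> c" "c \<le> m" "d \<in> {1..m}" for c d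
    using that(2,3)
  proof (induction c rule: dec_induct)
    case base
    then show ?case using that by simp
  next
    case (step c)
    then have "P (next_idx n c)"
      using assms(3) that by simp
    moreover have "next_idx n c = Suc c"
      using step n by (simp add: next_idx_def)
    ultimately show ?case by simp
  qed
  have "P m"
    using up[of a m] a by simp
  from step[OF _ this] have "P 1"
    using n m by (simp add: next_idx_def)
  then show ?thesis
    using up[of 1 b] b m by simp
qed

lemma rainbow_cycle_length:
  assumes cyc: "is_cycle (ladder_verts n) (ladder_edges n) p"
    and rb: "rainbow (ladder_colors n) (ladder_class n) (cycle_edges p)"
  shows "2 * m \<le> length p"
proof -
  have "set p \<noteq> {}" and p: "set p \<subseteq> {1..m} \<times> UNIV"
    using cyc by (auto simp: is_cycle_def ladder_verts_def n_div)
  then obtain a b where ab: "(a, b) \<in> set p"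
    by (metis ex_in_conv surj_pair)
  with p have a: "a \<in> {1..m}" "set p \<inter> {a} \<times> UNIV \<noteq> {}"
    by blast+
  note passage = block_passage[OF cyc rb _ _ rainbow_cycle_leaves_block[OF cyc rb]]
  have meets: "set p \<inter> {i} \<times> UNIV \<noteq> {}" if "i \<in> {1..m}" for i
    using next_idx_induct[where P = "\<lambda>i. set p \<inter> {i} \<times> UNIV \<noteq> {}", OF a passage(3) that]
    by blast
  \<comment> \<open>The flag \<open>b\<close> selects the entry side or the exit side of block
    \<open>i\<close>.\<close>
  have "\<exists>v\<in>set p. v \<in> {i} \<times> (if b then {1, 2} else {3, 4})" if "i \<in> {1..m}" for i b
    using passage(1,2)[OF that meets[OF that] that] by (cases b) auto
  then obtain g where g: "\<And>i b. i \<in> {1..m} \<Longrightarrow>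
      g i b \<in> set p \<and> g i b \<in> {i} \<times> (if b then {1, 2} else {3, 4})"
    by metis
  \<comment> \<open>Block and side can be read off from the chosen vertex, so the
    \<open>2 * m\<close> choices are distinct.\<close>
  have "inj_on (\<lambda>(i, b). g i b) ({1..m} \<times> UNIV)"
  proof (rule inj_onI, clarify)
    fix i b j c
    assume "i \<in> {1..m}" "j \<in> {1..m}" "g i b = g j c"
    with g[of i b] g[of j c] show "i = j \<and> b = c"
      by (cases b; cases c) auto
  qed
  moreover have "(\<lambda>(i, b). g i b) ` ({1..m} \<times> UNIV) \<subseteq> set p"
    using g by auto
  ultimately have "card ({1..m} \<times> (UNIV :: bool set)) \<le> card (set p)"
    by (intro card_inj_on_le) auto
  also have "\<dots> \<le> length p"
    by (rule card_length)
  finally show ?thesis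
    by (simp add: card_cartesian_product)
qed

section \<open>A rainbow cycle that attains the bound\<close>

lemma rail_cycle:
  defines "p \<equiv> map (\<lambda>k. (k div 2 + 1, if even k then 1 else 4 :: nat)) [0..<2 * m]"
  shows "length p = 2 * m" "is_cycle (ladder_verts n) (ladder_edges n) p"
    "rainbow (ladder_colors n) (ladder_class n) (cycle_edges p)"
proof -
  show len: "length p = 2 * m"
    by (simp add: p_def)
  \<comment> \<open>Positions \<open>2 * l\<close> and \<open>2 * l + 1\<close> hold the vertices 1
    and 4 of block \<open>l + 1\<close>, so the edges alternate between \<open>Rail41\<close> and
    one link of each \<open>Link\<close> class.\<close>
  have nth: "p ! k = (k div 2 + 1, if even k then 1 else 4)" if "k < 2 * m" for k
    using that by (simp add: p_def)
  have edges: "\<exists>i\<in>{1..m}. e = {(i, 4), (i, 1)} \<or> e = {(i, 4), (next_idx n i, 1)}"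
    if e: "e \<in> cycle_edges p" for e
  proof -
    obtain k where k: "k < 2 * m" and e: "e = {p ! k, p ! (Suc k mod (2 * m))}"
      using e unfolding cycle_edges_def len by blast
    have i: "k div 2 + 1 \<in> {1..m}"
      using k by auto
    show ?thesis
    proof (cases "even k")
      case True
      \<comment> \<open>The last position \<open>2 * m - 1\<close> is odd, so no wraparound occurs
        after an even one.\<close>
      then have "Suc k < 2 * m"
        using k by (auto elim!: evenE)
      then have "e = {(k div 2 + 1, 4), (k div 2 + 1, 1)}"
        using True k by (auto simp: e nth)
      then show ?thesis using i by blast
    next
      case False
      then obtain l where l: "k = 2 * l + 1"
        by (auto elim: oddE)
      \<comment> \<open>Halving turns the wraparound of positions into that of block indices, so the
        closing edge is the link from block \<open>m\<close> to block \<open>1\<close>.\<close>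
      have "Suc k mod (2 * m) = 2 * (Suc l mod m)"
        by (simp add: l mult_mod_right)
      moreover have "2 * (Suc l mod m) < 2 * m"
        using m by simp
      ultimately have "e = {(k div 2 + 1, 4), (next_idx n (k div 2 + 1), 1)}"
        using k n by (auto simp: e nth l next_idx_def)
      then show ?thesis using i by blast
    qed
  qed
  have "distinct p"
    unfolding p_def distinct_map
  proof (intro conjI inj_onI)
    fix k l :: nat
    assume "(k div 2 + 1, if even k then 1 else 4 :: nat) = (l div 2 + 1, if even l then 1 else 4)"
    then have "k div 2 = l div 2" "even k = even l"
      by (auto split: if_splits)
    then show "k = l"
      by (metis bit_eq_rec)
  qed simp
  moreover have "set p \<subseteq> ladder_verts n"
    using n by (auto simp: p_def ladder_verts_def)
  moreover have "cycle_edges p \<subseteq> ladder_edges n"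
  proof
    fix e
    assume "e \<in> cycle_edges p"
    from edges[OF this] obtain i where i: "i \<in> {1..m}"
      and "e = {(i, 4), (i, 1)} \<or> e = {(i, 4), (next_idx n i, 1)}"
      by (rule bexE)
    then have "e \<in> ladder_class n (i, Rail41) \<union> ladder_class n (i, Link)"
      by auto
    then show "e \<in> ladder_edges n"
      using ladder_class_subset[OF i] by blast
  qed
  ultimately show "is_cycle (ladder_verts n) (ladder_edges n) p"
    using m by (simp add: is_cycle_def len)
  show "rainbow (ladder_colors n) (ladder_class n) (cycle_edges p)"
    unfolding rainbow_def
  proof (intro ballI)
    fix c e f
    assume ef: "e \<in> cycle_edges p \<inter> ladder_class n c" "f \<in> cycle_edges p \<inter> ladder_class n c"
    obtain i k where c: "c = (i, k)"
      by (cases c)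
    \<comment> \<open>This names the only possible edge of the cycle in each class. For
      \<open>Rungs\<close> and \<open>Rail23\<close> there is no such \<open>d\<close>, and the
      \<open>else\<close> value is arbitrary.\<close>
    have "d = (if k = Rail41 then {(i, 4), (i, 1)} else {(i, 4), (next_idx n i, 1)})"
      if "d \<in> cycle_edges p" "d \<in> ladder_class n (i, k)" for d
    proof -
      from edges[OF that(1)] obtain j where j: "j \<in> {1..m}"
        and d: "d = {(j, 4), (j, 1)} \<or> d = {(j, 4), (next_idx n j, 1)}"
        by (rule bexE)
      from d that(2) show ?thesis
        using next_idx_neq[OF j]
        by (elim disjE; cases k) (simp_all add: doubleton_eq_iff)
    qed
    then show "e = f"
      using ef c by blast
  qed
qed

lemma rainbow_girth_ladder:
  "rainbow_girth (ladder_verts n) (ladder_edges n) (ladder_colors n) (ladder_class n)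
    = enat (n div 2)"
  unfolding rainbow_girth_def
proof (rule antisym)
  show "Inf {enat (length p) |p. is_cycle (ladder_verts n) (ladder_edges n) p \<and>
      rainbow (ladder_colors n) (ladder_class n) (cycle_edges p)} \<le> enat (n div 2)"
    by (rule Inf_lower) (use rail_cycle n in force)
  show "enat (n div 2) \<le> Inf {enat (length p) |p.
      is_cycle (ladder_verts n) (ladder_edges n) p \<and>
      rainbow (ladder_colors n) (ladder_class n) (cycle_edges p)}"
    using rainbow_cycle_length n by (auto intro!: Inf_greatest)
qed

end

theorem mainTheorem4:
  fixes n :: nat
  assumes "n \<ge> 8" and "4 dvd n"
  shows "finite_simple_graph (ladder_verts n) (ladder_edges n) \<and>
    card (ladder_verts n) = n \<and>
    edge_coloring (ladder_edges n) (ladder_colors n) (ladder_class n) \<and>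
    card (ladder_colors n) = n \<and>
    card {c \<in> ladder_colors n.
      matching (ladder_edges n) (ladder_class n c) \<and> card (ladder_class n c) = 2} = n div 2 \<and>
    card {c \<in> ladder_colors n. card (ladder_class n c) = 1} = n div 2 \<and>
    rainbow_girth (ladder_verts n) (ladder_edges n) (ladder_colors n) (ladder_class n)
      = enat (n div 2)"
proof -
  obtain m where n: "n = 4 * m"
    using assms(2) by (rule dvdE)
  with assms(1) have m: "m \<ge> 2" by simp
  have "card (ladder_verts n) = n" "card (ladder_colors n) = n"
    using n by (simp_all add: ladder_verts_def ladder_colors_def card_cartesian_product
        UNIV_color_kind)
  then show ?thesis
    using ladder_simple[OF n m] ladder_edge_coloring[OF n m] card_double_classes[OF n m]
      card_single_classes[OF n m] rainbow_girth_ladder[OF n m]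
    by blast
qed

end
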